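(* Let $X$ be a separable Banach space. If $B_X$ is the closed convex hull of a set of uniformly strongly exposed points, then $X^*$ has the uniform ball-covering property (UBCP) and $\operatorname{bc}(X^* )=1$.
   Context: All Banach spaces are real. $B_X$, $S_X$ denote the closed unit ball and the unit sphere; $B(x,r)$ is the open ball with center $x$ and radius $r>0$. A subset $U\subset S_X$ is a set of uniformly strongly exposed points if there is a family $\{f_u\}_{u\in U}\subset X^*$ with $\|f_u\|=f_u(u)=1$ for every $u\in U$, such that for every $\varepsilon>0$ there is $\delta>0$ such that whenever $z\in B_X$ and $u\in U$ satisfy $f_u(z)>1-\delta$, then $\|u-z\|<\varepsilon$. A Banach space $Z$ has the UBCP if there are $r,\alpha>0$ and a countable collection of open balls $\{B(z_n,r_n)\}$ with $S_Z\subset\bigcup_nB(z_n,r_n)$, $\|z_n\|\ge r_n+\alpha$ for all $n$, and $\sup_n r_n\le r$. For $\alpha\in[-1,1)$, $Z$ has the $\alpha$-BCP if there is a countable collection of open balls $\{B(z_n,r_n)\}$, $r_n>0$, with $S_Z\subset\bigcup_n B(z_n,r_n)$ and $\|z_n\|\ge r_n+\alpha$ for all $n$. The ball-covering index is $\operatorname{bc}(Z):=\sup\{\alpha\in[-1,1): Z\text{ has the }\alpha\text{-BCP}\}$ ($=-1$ if this set is empty). *)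

theory Defs
  imports "HOL-Analysis.Analysis"
begin

text \<open>
  The dual space of \<open>'a\<close> is the type \<open>'a \<Rightarrow>\<^sub>L real\<close> of bounded linear functionals with the
  operator norm.
\<close>

definition uniformly_strongly_exposed :: "'a::banach set \<Rightarrow> bool" where
  "uniformly_strongly_exposed U \<longleftrightarrow>
     U \<subseteq> sphere 0 1 \<and>
     (\<exists>f :: 'a \<Rightarrow> ('a \<Rightarrow>\<^sub>L real).
        (\<forall>u\<in>U. norm (f u) = 1 \<and> blinfun_apply (f u) u = 1) \<and>
        (\<forall>\<epsilon>>0. \<exists>\<delta>>0. \<forall>z\<in>cball 0 1. \<forall>u\<in>U.
           blinfun_apply (f u) z > 1 - \<delta> \<longrightarrow> norm (u - z) < \<epsilon>))"

text \<open>
  A countable collection of open balls is encoded as a countable set of pairs (centre, radius);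
  it may be finite, or empty when the unit sphere is.
\<close>

definition UBCP :: "'z::banach itself \<Rightarrow> bool" where
  "UBCP _ \<longleftrightarrow>
     (\<exists>R>0. \<exists>\<alpha>>0. \<exists>C :: ('z \<times> real) set.
        countable C \<and> (\<forall>(z, r)\<in>C. 0 < r) \<and>
        sphere 0 1 \<subseteq> (\<Union>(z, r)\<in>C. ball z r) \<and>
        (\<forall>(z, r)\<in>C. norm z \<ge> r + \<alpha>) \<and>
        (\<forall>(z, r)\<in>C. r \<le> R))"

definition BCP :: "real \<Rightarrow> 'z::banach itself \<Rightarrow> bool" where
  "BCP \<alpha> _ \<longleftrightarrow>
     (\<exists>C :: ('z \<times> real) set.
        countable C \<and> (\<forall>(z, r)\<in>C. 0 < r) \<and>
        sphere 0 1 \<subseteq> (\<Union>(z, r)\<in>C. ball z r) \<and>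
        (\<forall>(z, r)\<in>C. norm z \<ge> r + \<alpha>))"

definition bc :: "'z::banach itself \<Rightarrow> real" where
  "bc Z = (let A = {\<alpha> \<in> {-1..<1}. BCP \<alpha> Z} in if A = {} then -1 else Sup A)"

end

theory Submission
  imports Defs
begin

text \<open>
  The balls are centred at the multiples \<open>t f\<^sub>d\<close> of the exposing functionals, for \<open>d\<close> in a countable
  dense subset of \<open>U\<close>, and have radius \<open>t - \<alpha>\<close>. For a functional \<open>g\<close> of norm one choose \<open>d\<close> with
  \<open>g d\<close> close to 1. On the slice of the unit ball where \<open>f\<^sub>d > 1 - \<delta>\<close>, uniform exposedness makes \<open>g\<close>
  close to 1, so \<open>t f\<^sub>d - g\<close> is barely larger than \<open>t - 1\<close>; off the slice, \<open>t f\<^sub>d - g \<le> t - t \<delta> + 1 \<le> t - 1\<close>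
  as soon as \<open>t \<delta> \<ge> 2\<close>. Because \<open>\<delta>\<close> does not depend on \<open>d\<close>, neither does \<open>t\<close>.
\<close>

text \<open>The unit ball is symmetric, so testing \<open>h\<close> at \<open>sgn x\<close> and
  \<open>- sgn x\<close> turns a one-sided bound into one on the absolute value.\<close>

lemma norm_blinfun_le_cball:
  fixes h :: "'a::real_normed_vector \<Rightarrow>\<^sub>L real"
  assumes le: "\<And>z. z \<in> cball 0 1 \<Longrightarrow> blinfun_apply h z \<le> M"
  shows "norm h \<le> M"
proof (rule norm_blinfun_bound)
  show "0 \<le> M"
    using le[of 0] by (simp add: blinfun.zero_right)
  fix x :: 'a
  show "norm (blinfun_apply h x) \<le> M * norm x"
  proof (cases "x = 0")
    case False
    have "blinfun_apply h (sgn x) \<le> M" "blinfun_apply h (- sgn x) \<le> M"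
      by (auto intro!: le simp: norm_sgn)
    then have "\<bar>blinfun_apply h x\<bar> / norm x \<le> M"
      using False
      by (auto simp: sgn_div_norm blinfun.scaleR_right blinfun.minus_right abs_if divide_simps)
    then show ?thesis
      using False by (simp add: divide_simps)
  qed (simp add: blinfun.zero_right)
qed

text \<open>If \<open>g\<close> were at most \<open>c\<close> on all of \<open>U\<close>, the closed
  convex half-space \<open>g \<le> c\<close> would contain the unit ball.\<close>

lemma norm_blinfun_less_hull:
  fixes g :: "'a::real_normed_vector \<Rightarrow>\<^sub>L real"
  assumes hull: "cball (0::'a) 1 \<subseteq> closure (convex hull U)"
    and "c < norm g"
  obtains u where "u \<in> U" "c < blinfun_apply g u"
proof -
  have "\<exists>u\<in>U. c < blinfun_apply g u"
  proof (rule ccontr)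
    assume "\<not> ?thesis"
    then have "U \<subseteq> blinfun_apply g -` {..c}"
      by force
    moreover have "convex (blinfun_apply g -` {..c})"
      by (intro convex_linear_vimage bounded_linear.linear blinfun.bounded_linear_right) simp
    moreover have "closed (blinfun_apply g -` {..c})"
      by (intro continuous_closed_vimage) (auto intro: continuous_intros)
    ultimately have "closure (convex hull U) \<subseteq> blinfun_apply g -` {..c}"
      by (intro closure_minimal hull_minimal)
    then have "norm g \<le> c"
      using hull by (intro norm_blinfun_le_cball) auto
    with \<open>c < norm g\<close> show False
      by simp
  qed
  then show thesis
    using that by blast
qed

text \<open>A dense \<open>E\<close> may miss \<open>U\<close>, so a point of \<open>U\<close> is
  picked near each point of \<open>E\<close> at each scale \<open>1/(n+1)\<close> where one
  exists.\<close>

lemma countable_dense_subset: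
  fixes U :: "'a::metric_space set"
  assumes "separable_space (euclidean :: 'a topology)"
  obtains D where "countable D" "D \<subseteq> U" "U \<subseteq> closure D"
proof -
  obtain E :: "'a set" where E: "countable E" "closure E = UNIV"
    using assms by (auto simp: separable_space_def)
  define I where "I = {(x, n). x \<in> E \<and> (\<exists>u\<in>U. dist x u < inverse (real (Suc n)))}"
  have "\<forall>i\<in>I. \<exists>u. u \<in> U \<and> dist (fst i) u < inverse (real (Suc (snd i)))"
    by (auto simp: I_def)
  then obtain p where p: "\<And>i. i \<in> I \<Longrightarrow> p i \<in> U \<and> dist (fst i) (p i) < inverse (real (Suc (snd i)))"
    unfolding bchoice_iff by blast
  have "I \<subseteq> E \<times> UNIV"
    by (auto simp: I_def)
  then have "countable I"
    by (rule countable_subset) (simp add: E)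
  then have "countable (p ` I)"
    by (rule countable_image)
  moreover have "p ` I \<subseteq> U"
    by (rule image_subsetI, rule conjunct1, rule p)
  moreover have "U \<subseteq> closure (p ` I)"
  proof
    fix u
    assume "u \<in> U"
    show "u \<in> closure (p ` I)"
      unfolding closure_approachable
    proof (intro allI impI)
      fix e :: real
      assume "0 < e"
      then obtain n where n: "inverse (real (Suc n)) < e / 2"
        using reals_Archimedean[of "e / 2"] by auto
      have "u \<in> closure E" "0 < inverse (real (Suc n))"
        using E by simp_all
      then obtain x where x: "x \<in> E" "dist x u < inverse (real (Suc n))"
        unfolding closure_approachable by blast
      then have xn: "(x, n) \<in> I"
        using \<open>u \<in> U\<close> by (auto simp: I_def)
      \<comment> \<open>Both \<open>u\<close> and \<open>p (x, n)\<close> lie within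
        \<open>e / 2\<close> of \<open>x\<close>.\<close>
      have "dist (p (x, n)) u < e"
        using dist_triangle3[of "p (x, n)" u x] p[OF xn] x n by simp
      then show "\<exists>y\<in>p ` I. dist y u < e"
        using xn by blast
    qed
  qed
  ultimately show thesis
    by (rule that)
qed

text \<open>The radius common to all balls gives the uniform bound in the UBCP; the free choice of
  \<open>\<alpha>\<close> gives the index.\<close>

lemma ball_covering_dual:
  fixes U :: "'a::banach set"
  assumes separable: "separable_space (euclidean :: 'a topology)"
    and exposed: "uniformly_strongly_exposed U"
    and hull: "cball (0::'a) 1 = closure (convex hull U)"
    and \<alpha>: "\<alpha> < 1"
  obtains R and C :: "(('a \<Rightarrow>\<^sub>L real) \<times> real) set"
  where "0 < R" "countable C" "sphere 0 1 \<subseteq> (\<Union>(z, r)\<in>C. ball z r)"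
    "\<And>z r. (z, r) \<in> C \<Longrightarrow> r = R \<and> r + \<alpha> \<le> norm z"
proof -
  \<comment> \<open>One \<open>e\<close> is lost in choosing \<open>d\<close>, one in moving from
    \<open>d\<close> to \<open>z\<close>; the third makes the final inequality strict.\<close>
  define e where "e = (1 - \<alpha>) / 3"
  have e: "0 < e" "1 - 3 * e = \<alpha>"
    using \<alpha> by (auto simp: e_def field_simps)
  from exposed obtain f :: "'a \<Rightarrow> 'a \<Rightarrow>\<^sub>L real" where
    f: "\<And>u. u \<in> U \<Longrightarrow> norm (f u) = 1" and
    slice: "\<forall>\<epsilon>>0. \<exists>\<delta>>0. \<forall>z\<in>cball 0 1. \<forall>u\<in>U. 1 - \<delta> < blinfun_apply (f u) z \<longrightarrow> norm (u - z) < \<epsilon>"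
    unfolding uniformly_strongly_exposed_def by metis
  from slice e obtain \<delta> where "0 < \<delta>" and
    \<delta>: "\<And>z u. \<lbrakk>z \<in> cball 0 1; u \<in> U; 1 - \<delta> < blinfun_apply (f u) z\<rbrakk> \<Longrightarrow> norm (u - z) < e"
    by metis
  \<comment> \<open>The term \<open>2 / \<delta>\<close> handles points off the slice; the added 2
    keeps the radius \<open>t - \<alpha>\<close> positive.\<close>
  define t where "t = 2 + 2 / \<delta>"
  have t: "2 \<le> t" "2 \<le> t * \<delta>"
    using \<open>0 < \<delta>\<close> by (auto simp: t_def field_simps)
  obtain D where D: "countable D" "D \<subseteq> U" "U \<subseteq> closure D"
    using countable_dense_subset[OF separable] .
  \<comment> \<open>Passing to \<open>D\<close> makes the family of balls countable. The closed
    convex hull of \<open>D\<close> contains \<open>U\<close>, hence still the whole ball.\<close>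
  have hull_D: "cball 0 1 \<subseteq> closure (convex hull D)"
  proof -
    have "convex hull U \<subseteq> closure (convex hull D)"
      using D(3) closure_mono[OF hull_subset[of D convex]]
      by (intro hull_minimal) (auto intro: convex_closure)
    then show ?thesis
      unfolding hull by (simp add: closure_minimal)
  qed
  \<comment> \<open>Since \<open>norm (f d) = 1\<close>, each centre has norm exactly
    \<open>t\<close>, which exceeds the radius by \<open>\<alpha>\<close>.\<close>
  define C where "C = (\<lambda>d. (t *\<^sub>R f d, t - \<alpha>)) ` D"
  have "sphere 0 1 \<subseteq> (\<Union>(z, r)\<in>C. ball z r)"
  proof
    fix g :: "'a \<Rightarrow>\<^sub>L real"
    assume "g \<in> sphere 0 1"
    then have g: "norm g = 1"
      by simp
    have g_le: "\<bar>blinfun_apply g x\<bar> \<le> norm x" for x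
      using norm_blinfun[of g x] g by simp
    obtain d where d: "d \<in> D" "1 - e < blinfun_apply g d"
      using norm_blinfun_less_hull[OF hull_D, of "1 - e" g] g e by auto
    have "d \<in> U"
      using d D by blast
    have "norm (t *\<^sub>R f d - g) \<le> t - 1 + 2 * e"
    proof (rule norm_blinfun_le_cball)
      fix z :: 'a
      assume z: "z \<in> cball 0 1"
      have "t * blinfun_apply (f d) z - blinfun_apply g z \<le> t - 1 + 2 * e"
      proof (cases "1 - \<delta> < blinfun_apply (f d) z")
        case True
        have "blinfun_apply (f d) z \<le> 1"
          using norm_blinfun[of "f d" z] f[OF \<open>d \<in> U\<close>] z by simp
        then have "t * blinfun_apply (f d) z \<le> t"
          using t by simp
        \<comment> \<open>As \<open>g\<close> has norm one, its values at \<open>d\<close> and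
          \<open>z\<close> differ by less than \<open>e\<close>, so
          \<open>g z > 1 - 2 * e\<close>.\<close>
        moreover have "blinfun_apply g d - blinfun_apply g z < e"
          using g_le[of "d - z"] \<delta>[OF z \<open>d \<in> U\<close> True] by (simp add: blinfun.diff_right)
        ultimately show ?thesis
          using d by linarith
      next
        case False
        then have "t * blinfun_apply (f d) z \<le> t * (1 - \<delta>)"
          using t by (intro mult_left_mono) auto
        then show ?thesis
          using g_le[of z] z t e by (simp add: algebra_simps)
      qed
      then show "blinfun_apply (t *\<^sub>R f d - g) z \<le> t - 1 + 2 * e"
        by (simp add: blinfun.diff_left blinfun.scaleR_left)
    qed
    also have "\<dots> < t - \<alpha>"
      using e by linarith
    finally have "g \<in> ball (t *\<^sub>R f d) (t - \<alpha>)"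
      by (simp add: dist_norm)
    then show "g \<in> (\<Union>(z, r)\<in>C. ball z r)"
      using d by (force simp: C_def)
  qed
  moreover have "countable C" "0 < t - \<alpha>"
    using D t \<alpha> by (auto simp: C_def)
  moreover have "r = t - \<alpha> \<and> r + \<alpha> \<le> norm z" if "(z, r) \<in> C" for z r
    using that D f t by (auto simp: C_def)
  ultimately show thesis
    using that by blast
qed

theorem theorem3p6:
  fixes U :: "'a::banach set"
  assumes separable: "separable_space (euclidean :: 'a topology)"
    and exposed: "uniformly_strongly_exposed U"
    and hull: "cball (0::'a) 1 = closure (convex hull U)"
  shows "UBCP TYPE('a \<Rightarrow>\<^sub>L real) \<and> bc TYPE('a \<Rightarrow>\<^sub>L real) = 1"
proof
  note covering = ball_covering_dual[OF separable exposed hull]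
  show "UBCP TYPE('a \<Rightarrow>\<^sub>L real)"
  proof (rule covering)
    \<comment> \<open>Any value strictly between 0 and 1 would serve as the gap.\<close>
    show "(1/2::real) < 1"
      by simp
    fix R and C :: "(('a \<Rightarrow>\<^sub>L real) \<times> real) set"
    assume "0 < R" "countable C" "sphere 0 1 \<subseteq> (\<Union>(z, r)\<in>C. ball z r)"
      and C: "\<And>z r. (z, r) \<in> C \<Longrightarrow> r = R \<and> r + 1/2 \<le> norm z"
    moreover have
      "\<forall>(z, r)\<in>C. 0 < r" "\<forall>(z, r)\<in>C. r + 1/2 \<le> norm z" "\<forall>(z, r)\<in>C. r \<le> R"
      using \<open>0 < R\<close> C by blast+
    ultimately show ?thesis
      unfolding UBCP_def
      by (intro exI[of _ R] exI[of _ "1/2"] exI[of _ C] conjI) simp_all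
  qed
  have "BCP \<alpha> TYPE('a \<Rightarrow>\<^sub>L real)" if "\<alpha> < 1" for \<alpha>
  proof (rule covering[OF that])
    fix R and C :: "(('a \<Rightarrow>\<^sub>L real) \<times> real) set"
    assume "0 < R" "countable C" "sphere 0 1 \<subseteq> (\<Union>(z, r)\<in>C. ball z r)"
      and C: "\<And>z r. (z, r) \<in> C \<Longrightarrow> r = R \<and> r + \<alpha> \<le> norm z"
    moreover have "\<forall>(z, r)\<in>C. 0 < r" "\<forall>(z, r)\<in>C. r + \<alpha> \<le> norm z"
      using \<open>0 < R\<close> C by blast+
    ultimately show ?thesis
      unfolding BCP_def by (intro exI[of _ C] conjI)
  qed
  \<comment> \<open>Every index in the interval is admissible, so the default -1 in
    \<open>bc\<close> is not taken and the supremum is 1.\<close>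
  then have "{\<alpha> \<in> {-1..<1}. BCP \<alpha> TYPE('a \<Rightarrow>\<^sub>L real)} = {-1..<1}"
    by auto
  then show "bc TYPE('a \<Rightarrow>\<^sub>L real) = 1"
    by (simp add: bc_def)
qed

end
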